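(* For every set of events $cs$, state predicates $s_1,s_2$, trace expressions $t_1,t_2$, event-set expressions $E_1,E_2$ and $\sigma_2:\Sigma\to\Sigma$: $\mathcal{E}(s_1,t_1,E_1)\bowtie_I^{cs}\mathcal{E}(s_2,t_2,E_2) = \exists t\bullet\mathcal{E}(s_1\wedge s_2\wedge t\in t_1\parallel_{cs}t_2\wedge t_1\restriction cs = t_2\restriction cs,\ t,\ (E_1\cap E_2\cap cs)\cup((E_1\cup E_2)\setminus cs))$, and $\mathcal{E}(s_1,t_1,E_1)\bowtie_I^{cs}\Phi(s_2,\sigma_2,t_2) = \exists t\bullet\mathcal{E}(s_1\wedge s_2\wedge t\in t_1\parallel_{cs}t_2\wedge t_1\restriction cs = t_2\restriction cs,\ t,\ E_1\setminus cs)$.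
   Context: UTP setting: relations are predicates over undashed (initial) and dashed (final) variables; $;$ is relational composition; $P\lhd c\rhd Q = (c\wedge P)\vee(\neg c\wedge Q)$. Observational variables: booleans $ok,ok',wait,wait'$; traces $tr,tr'$ (finite event sequences; $\le$ prefix, ${}^\frown$ concatenation, $-$ removal of a prefix); state $st,st'\in\Sigma$; refusal sets $ref,ref'$; $tt$ abbreviates $tr'-tr$. $\mathbf{R1}(P) = P\wedge tr\le tr'$; $\mathbf{R2}(P) = P[\langle\rangle,tr'-tr/tr,tr']\lhd tr\le tr'\rhd P$; $\mathbf{RR}(P)=\exists ok,ok',wait,wait'\bullet\mathbf{R1}(\mathbf{R2}(P))$; $\mathbf{CRR}(P)=\exists ref\bullet\mathbf{RR}(P)$. For a state predicate $s$, trace-valued expression $t$, event-set-valued expression $A$ over $st$, and $\sigma:\Sigma\to\Sigma$: $\mathcal{E}(s,t,A) = \mathbf{CRR}(s\wedge tt=t\wedge\forall e\in A\bullet e\notin ref')$, $\Phi(s,\sigma,t) = \mathbf{CRR}(s\wedge st' = \sigma(st)\wedge tt = t)$. Lenses: a lens $X:V\Rightarrow\Sigma$ is a pair $get_X,put_X$ satisfying $get(put\,s\,v)=v$, $put(put\,s\,v')\,v = put\,s\,v$, $put\,s\,(get\,s)=s$; override $s_1\oplus_X s_2 = put_X\,s_1\,(get_X\,s_2)$; $\mathbf{0}$ is the lens with a singleton view ($put\,s\,v=s$). Parallel-by-merge: $P\parallel_M Q = (P_0\wedge Q_1\wedge v'=v);M$, with $v$ the tuple of all variables, $P_0$ ($Q_1$)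 obtained by renaming each dashed $x'$ of $P$ ($Q$) to $0.x$ ($1.x$), and $M$ relating $x,0.x,1.x$ to $x'$. Trace merge $\parallel_{cs}$: least function from pairs of event sequences to sets of sequences with $\langle\rangle\parallel_{cs}\langle\rangle = \{\langle\rangle\}$; $(e{:}u)\parallel_{cs}\langle\rangle$ and $\langle\rangle\parallel_{cs}(e{:}u)$ equal $\{\langle\rangle\}$ if $e\in cs$, otherwise $\{\langle e\rangle\}{}^\frown(u\parallel_{cs}\langle\rangle)$, resp. $\{\langle e\rangle\}{}^\frown(\langle\rangle\parallel_{cs}u)$; $(e{:}u_1)\parallel_{cs}(e{:}u_2)=\{\langle e\rangle\}{}^\frown(u_1\parallel_{cs}u_2)$ if $e\in cs$, else $\{\langle e\rangle\}{}^\frown(u_1\parallel_{cs}(e{:}u_2)\cup(e{:}u_1)\parallel_{cs}u_2)$; for $e_1\neq e_2$: $\{\langle\rangle\}$ if both in $cs$, $\{\langle e_2\rangle\}{}^\frown((e_1{:}u_1)\parallel_{cs}u_2)$ if only $e_1\in cs$, $\{\langle e_1\rangle\}{}^\frown(u_1\parallel_{cs}(e_2{:}u_2))$ if only $e_2\in cs$, the union of these two if neither. $S{}^\frown T=\{a{}^\frown b\mid a\in S,b\in T\}$; $u\restriction cs$ is the subsequence of elements of $u$ in $cs$. Merge: $N(ns_1,cs,ns_2) = (tt\in0.tt\parallel_{cs}1.tt\wedge 0.tt\restriction cs = 1.tt\restriction cs\wedge ref'\subseteq((0.ref\cup1.ref)\cap cs)\cup((0.ref\cap1.ref)\setminus cs)\wedge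 st' = (st\oplus_{ns_1}0.st)\oplus_{ns_2}1.st)$, $0.tt = 0.tr-tr$, $1.tt = 1.tr - tr$; $N_I = N(\mathbf{0},cs,\mathbf{0})$; intermediate merge $P\bowtie_I^{cs}Q = P\parallel_{\exists st'\bullet N_I}Q$. *)

theory Defs
  imports Main "HOL-Library.Sublist"
begin

section \<open>Lenses\<close>

record ('v, 's) lens =
  get :: "'s \<Rightarrow> 'v"
  put :: "'s \<Rightarrow> 'v \<Rightarrow> 's"

definition is_lens :: "('v, 's) lens \<Rightarrow> bool" where
  "is_lens X \<longleftrightarrow>
     (\<forall>s v. get X (put X s v) = v) \<and>
     (\<forall>s v v'. put X (put X s v') v = put X s v) \<and>
     (\<forall>s. put X s (get X s) = s)"

definition override :: "'s \<Rightarrow> ('v, 's) lens \<Rightarrow> 's \<Rightarrow> 's" where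
  "override s1 X s2 = put X s1 (get X s2)"

definition zero_lens :: "(unit, 's) lens" where
  "zero_lens = \<lparr>get = (\<lambda>s. ()), put = (\<lambda>s v. s)\<rparr>"

lemma is_lens_zero_lens: "is_lens zero_lens"
  by (simp add: is_lens_def zero_lens_def)

section \<open>Reactive relations\<close>

record ('s, 'e) obs =
  ok :: bool
  wait :: bool
  tr :: "'e list"
  st :: 's
  ref :: "'e set"

text \<open>The first argument holds the undashed variables, the second the dashed ones.\<close>

type_synonym ('s, 'e) urel = "('s, 'e) obs \<Rightarrow> ('s, 'e) obs \<Rightarrow> bool"

definition rcond :: "('s, 'e) urel \<Rightarrow> ('s, 'e) urel \<Rightarrow> ('s, 'e) urel \<Rightarrow> ('s, 'e) urel" where
  "rcond P c Q = (\<lambda>v v'. (c v v' \<and> P v v') \<or> (\<not> c v v' \<and> Q v v'))"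

text \<open>Removal of the prefix \<open>u\<close> from \<open>w\<close>; meaningful only if \<open>prefix u w\<close>.\<close>

definition trace_minus :: "'e list \<Rightarrow> 'e list \<Rightarrow> 'e list" where
  "trace_minus w u = drop (length u) w"

definition tt :: "('s, 'e) obs \<Rightarrow> ('s, 'e) obs \<Rightarrow> 'e list" where
  "tt v v' = trace_minus (tr v') (tr v)"

definition R1 :: "('s, 'e) urel \<Rightarrow> ('s, 'e) urel" where
  "R1 P = (\<lambda>v v'. P v v' \<and> prefix (tr v) (tr v'))"

definition R2 :: "('s, 'e) urel \<Rightarrow> ('s, 'e) urel" where
  "R2 P = rcond (\<lambda>v v'. P (v\<lparr>tr := []\<rparr>) (v'\<lparr>tr := trace_minus (tr v') (tr v)\<rparr>))
                (\<lambda>v v'. prefix (tr v) (tr v'))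
                P"

definition RR :: "('s, 'e) urel \<Rightarrow> ('s, 'e) urel" where
  "RR P = (\<lambda>v v'. \<exists>ok0 ok1 wait0 wait1.
     R1 (R2 P) (v\<lparr>ok := ok0, wait := wait0\<rparr>) (v'\<lparr>ok := ok1, wait := wait1\<rparr>))"

definition CRR :: "('s, 'e) urel \<Rightarrow> ('s, 'e) urel" where
  "CRR P = (\<lambda>v v'. \<exists>ref0. RR P (v\<lparr>ref := ref0\<rparr>) v')"

text \<open>No definedness condition for \<open>tt\<close> is needed in the next two definitions, since
  \<^const>\<open>CRR\<close> imposes \<^const>\<open>R1\<close>.\<close>

definition Ecsp :: "('s \<Rightarrow> bool) \<Rightarrow> ('s \<Rightarrow> 'e list) \<Rightarrow> ('s \<Rightarrow> 'e set) \<Rightarrow> ('s, 'e) urel" where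
  "Ecsp s t A = CRR (\<lambda>v v'. s (st v) \<and> tt v v' = t (st v) \<and> (\<forall>e\<in>A (st v). e \<notin> ref v'))"

definition Phi :: "('s \<Rightarrow> bool) \<Rightarrow> ('s \<Rightarrow> 's) \<Rightarrow> ('s \<Rightarrow> 'e list) \<Rightarrow> ('s, 'e) urel" where
  "Phi s \<sigma> t = CRR (\<lambda>v v'. s (st v) \<and> st v' = \<sigma> (st v) \<and> tt v v' = t (st v))"

section \<open>Trace merge\<close>

definition seqs_cat :: "'e list set \<Rightarrow> 'e list set \<Rightarrow> 'e list set" where
  "seqs_cat S T = {a @ b | a b. a \<in> S \<and> b \<in> T}"

fun trace_merge :: "'e set \<Rightarrow> 'e list \<Rightarrow> 'e list \<Rightarrow> 'e list set" where
  "trace_merge cs [] [] = {[]}"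
| "trace_merge cs (e # u) [] =
     (if e \<in> cs then {[]} else seqs_cat {[e]} (trace_merge cs u []))"
| "trace_merge cs [] (e # u) =
     (if e \<in> cs then {[]} else seqs_cat {[e]} (trace_merge cs [] u))"
| "trace_merge cs (e1 # u1) (e2 # u2) =
     (if e1 = e2 then
        (if e1 \<in> cs then seqs_cat {[e1]} (trace_merge cs u1 u2)
         else seqs_cat {[e1]} (trace_merge cs u1 (e2 # u2) \<union> trace_merge cs (e1 # u1) u2))
      else if e1 \<in> cs \<and> e2 \<in> cs then {[]}
      else if e1 \<in> cs then seqs_cat {[e2]} (trace_merge cs (e1 # u1) u2)
      else if e2 \<in> cs then seqs_cat {[e1]} (trace_merge cs u1 (e2 # u2))
      else seqs_cat {[e1]} (trace_merge cs u1 (e2 # u2)) \<union>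
           seqs_cat {[e2]} (trace_merge cs (e1 # u1) u2))"

definition trace_restrict :: "'e list \<Rightarrow> 'e set \<Rightarrow> 'e list" where
  "trace_restrict u cs = filter (\<lambda>e. e \<in> cs) u"

section \<open>Parallel-by-merge\<close>

text \<open>The left argument of a merge predicate is the triple of the variables
  \<open>x\<close>, \<open>0.x\<close> and \<open>1.x\<close>.\<close>

type_synonym ('s, 'e) merge_pred =
  "('s, 'e) obs \<times> ('s, 'e) obs \<times> ('s, 'e) obs \<Rightarrow> ('s, 'e) obs \<Rightarrow> bool"

definition par_by_merge ::
  "('s, 'e) urel \<Rightarrow> ('s, 'e) merge_pred \<Rightarrow> ('s, 'e) urel \<Rightarrow> ('s, 'e) urel" where
  "par_by_merge P M Q = (\<lambda>v (v', v0, v1). P v v0 \<and> Q v v1 \<and> v' = v) OO M"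

text \<open>The three prefix conditions say that \<open>tt\<close>, \<open>0.tt\<close> and \<open>1.tt\<close> are defined: an
  atomic predicate on an undefined trace difference is read as false. With a total
  difference instead, a merge with an empty result would allow final traces that do not
  extend the initial one.\<close>

definition merge_N ::
  "('v, 's) lens \<Rightarrow> 'e set \<Rightarrow> ('w, 's) lens \<Rightarrow> ('s, 'e) merge_pred" where
  "merge_N ns1 cs ns2 = (\<lambda>(v, v0, v1) v'.
     prefix (tr v) (tr v') \<and> prefix (tr v) (tr v0) \<and> prefix (tr v) (tr v1) \<and>
     tt v v' \<in> trace_merge cs (tt v v0) (tt v v1) \<and>
     trace_restrict (tt v v0) cs = trace_restrict (tt v v1) cs \<and>
     ref v' \<subseteq> ((ref v0 \<union> ref v1) \<inter> cs) \<union> ((ref v0 \<inter> ref v1) - cs) \<and>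
     st v' = override (override (st v) ns1 (st v0)) ns2 (st v1))"

definition merge_NI :: "'e set \<Rightarrow> ('s, 'e) merge_pred" where
  "merge_NI cs = merge_N zero_lens cs zero_lens"

definition imerge :: "('s, 'e) urel \<Rightarrow> 'e set \<Rightarrow> ('s, 'e) urel \<Rightarrow> ('s, 'e) urel" where
  "imerge P cs Q = par_by_merge P (\<lambda>m v'. \<exists>st1. merge_NI cs m (v'\<lparr>st := st1\<rparr>)) Q"

end

theory Submission
  imports Defs
begin

text \<open>Both equations are checked pointwise, after stripping the healthiness closures
  (\<open>Ecsp_iff\<close>, \<open>Phi_iff\<close>) and unfolding the merge
  (\<open>imerge_iff\<close>). The operands force the intermediate traces to contribute
  \<open>t1\<close> and \<open>t2\<close>, and the merged state is hidden, so what remains is a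
  choice of two refusal sets. The refusal bound is monotone in both, so the largest choice decides:
  \<open>- E1\<close> and \<open>- E2\<close>, whose bound has exactly the stated event set as
  complement. \<open>Phi\<close> leaves refusals free, which amounts to an empty \<open>E2\<close>
  and leaves \<open>E1 - cs\<close>.\<close>

lemma R1_R2_iff:
  "R1 (R2 P) v v' \<longleftrightarrow>
     prefix (tr v) (tr v') \<and> P (v\<lparr>tr := []\<rparr>) (v'\<lparr>tr := tt v v'\<rparr>)"
  by (auto simp: R1_def R2_def rcond_def tt_def)

text \<open>Resetting the initial trace to \<open>[]\<close> and the final one to
  \<open>tt v v'\<close> preserves their difference, so predicates over \<open>st\<close>,
  \<open>tt\<close>, \<open>st'\<close> and \<open>ref'\<close> pass through \<open>CRR\<close>
  gaining only the prefix condition.\<close>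

lemma CRR_iff:
  "CRR P v v' \<longleftrightarrow> prefix (tr v) (tr v') \<and>
     (\<exists>ref0 ok0 ok1 wait0 wait1.
        P (v\<lparr>ok := ok0, wait := wait0, tr := [], ref := ref0\<rparr>)
          (v'\<lparr>ok := ok1, wait := wait1, tr := tt v v'\<rparr>))"
  by (cases v; cases v') (simp add: CRR_def RR_def R1_R2_iff tt_def)

lemma Ecsp_iff:
  "Ecsp s t A v v' \<longleftrightarrow> prefix (tr v) (tr v') \<and> s (st v) \<and> tt v v' = t (st v) \<and>
     A (st v) \<inter> ref v' = {}"
  by (auto simp: Ecsp_def CRR_iff tt_def trace_minus_def)

lemma Phi_iff:
  "Phi s \<sigma> t v v' \<longleftrightarrow> prefix (tr v) (tr v') \<and> s (st v) \<and> st v' = \<sigma> (st v) \<and>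
     tt v v' = t (st v)"
  by (auto simp: Phi_def CRR_iff tt_def trace_minus_def)

text \<open>Zero lenses make the merged state \<open>st v\<close>; taking this for the hidden final
  state discharges the state equation.\<close>

lemma imerge_iff:
  "imerge P cs Q v v' \<longleftrightarrow> prefix (tr v) (tr v') \<and>
     (\<exists>v0 v1. P v v0 \<and> Q v v1 \<and> prefix (tr v) (tr v0) \<and> prefix (tr v) (tr v1) \<and>
        tt v v' \<in> trace_merge cs (tt v v0) (tt v v1) \<and>
        trace_restrict (tt v v0) cs = trace_restrict (tt v v1) cs \<and>
        ref v' \<subseteq> ((ref v0 \<union> ref v1) \<inter> cs) \<union> ((ref v0 \<inter> ref v1) - cs))"
proof -
  have tt_st: "tt u (v'\<lparr>st := s\<rparr>) = tt u v'" for u s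
    by (simp add: tt_def)
  show ?thesis
    unfolding imerge_def par_by_merge_def relcompp.simps merge_NI_def merge_N_def
    by (simp add: tt_st override_def zero_lens_def split_paired_Ex) blast
qed

lemma ex_obs_extension:
  "\<exists>v'. prefix (tr v) (tr v') \<and> tt v v' = t \<and> st v' = s \<and> ref v' = R"
  by (rule exI[of _ "v\<lparr>tr := tr v @ t, st := s, ref := R\<rparr>"])
    (simp add: tt_def trace_minus_def)

lemma imerge_Ecsp_Ecsp_iff:
  "imerge (Ecsp s1 t1 E1) cs (Ecsp s2 t2 E2) v v' \<longleftrightarrow>
     prefix (tr v) (tr v') \<and> s1 (st v) \<and> s2 (st v) \<and>
     tt v v' \<in> trace_merge cs (t1 (st v)) (t2 (st v)) \<and>
     trace_restrict (t1 (st v)) cs = trace_restrict (t2 (st v)) cs \<and>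
     ((E1 (st v) \<inter> E2 (st v) \<inter> cs) \<union> ((E1 (st v) \<union> E2 (st v)) - cs)) \<inter> ref v' = {}"
  (is "?L \<longleftrightarrow> ?R")
proof
  \<comment> \<open>An event of \<open>ref v'\<close> in \<open>cs\<close> is refused by some side,
    so it avoids \<open>E1\<close> or \<open>E2\<close>; one outside \<open>cs\<close> is refused by
    both and avoids both.\<close>
  show "?L \<Longrightarrow> ?R"
    unfolding imerge_iff Ecsp_iff by (elim exE conjE) (simp, blast)
next
  assume R: ?R
  \<comment> \<open>The largest refusals the two sides allow make the merged refusal as large as possible.\<close>
  obtain v0 where v0: "prefix (tr v) (tr v0)" "tt v v0 = t1 (st v)" "ref v0 = - E1 (st v)"
    using ex_obs_extension by metis
  obtain v1 where v1: "prefix (tr v) (tr v1)" "tt v v1 = t2 (st v)" "ref v1 = - E2 (st v)"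
    using ex_obs_extension by metis
  have "ref v' \<subseteq> ((ref v0 \<union> ref v1) \<inter> cs) \<union> ((ref v0 \<inter> ref v1) - cs)"
    using R v0(3) v1(3) by blast
  moreover have "Ecsp s1 t1 E1 v v0" "Ecsp s2 t2 E2 v v1"
    using R v0 v1 by (simp_all add: Ecsp_iff)
  ultimately show ?L
    using R v0(1,2) v1(1,2) unfolding imerge_iff by metis
qed

lemma imerge_Ecsp_Phi_iff:
  "imerge (Ecsp s1 t1 E1) cs (Phi s2 \<sigma>2 t2) v v' \<longleftrightarrow>
     prefix (tr v) (tr v') \<and> s1 (st v) \<and> s2 (st v) \<and>
     tt v v' \<in> trace_merge cs (t1 (st v)) (t2 (st v)) \<and>
     trace_restrict (t1 (st v)) cs = trace_restrict (t2 (st v)) cs \<and>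
     (E1 (st v) - cs) \<inter> ref v' = {}"
  (is "?L \<longleftrightarrow> ?R")
proof
  show "?L \<Longrightarrow> ?R"
    unfolding imerge_iff Ecsp_iff Phi_iff by (elim exE conjE) (simp, blast)
next
  assume R: ?R
  obtain v0 where v0: "prefix (tr v) (tr v0)" "tt v v0 = t1 (st v)" "ref v0 = - E1 (st v)"
    using ex_obs_extension by metis
  \<comment> \<open>\<open>Phi\<close> fixes the final state but not the refusals, so
    \<open>UNIV\<close> is the largest choice here.\<close>
  obtain v1 where v1: "prefix (tr v) (tr v1)" "tt v v1 = t2 (st v)"
      "st v1 = \<sigma>2 (st v)" "ref v1 = UNIV"
    using ex_obs_extension by metis
  have "ref v' \<subseteq> ((ref v0 \<union> ref v1) \<inter> cs) \<union> ((ref v0 \<inter> ref v1) - cs)"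
    using R v0(3) v1(4) by blast
  moreover have "Ecsp s1 t1 E1 v v0" "Phi s2 \<sigma>2 t2 v v1"
    using R v0 v1 by (simp_all add: Ecsp_iff Phi_iff)
  ultimately show ?L
    using R v0(1,2) v1(1,2) unfolding imerge_iff by metis
qed

theorem theorem42:
  fixes cs :: "'e set"
    and s\<^sub>1 s\<^sub>2 :: "'s \<Rightarrow> bool"
    and t\<^sub>1 t\<^sub>2 :: "'s \<Rightarrow> 'e list"
    and E\<^sub>1 E\<^sub>2 :: "'s \<Rightarrow> 'e set"
    and \<sigma>\<^sub>2 :: "'s \<Rightarrow> 's"
  shows
    "imerge (Ecsp s\<^sub>1 t\<^sub>1 E\<^sub>1) cs (Ecsp s\<^sub>2 t\<^sub>2 E\<^sub>2) =
       (\<lambda>v v'. \<exists>t. Ecsp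
          (\<lambda>s. s\<^sub>1 s \<and> s\<^sub>2 s \<and> t \<in> trace_merge cs (t\<^sub>1 s) (t\<^sub>2 s) \<and>
               trace_restrict (t\<^sub>1 s) cs = trace_restrict (t\<^sub>2 s) cs)
          (\<lambda>s. t)
          (\<lambda>s. (E\<^sub>1 s \<inter> E\<^sub>2 s \<inter> cs) \<union> ((E\<^sub>1 s \<union> E\<^sub>2 s) - cs)) v v')
     \<and>
     imerge (Ecsp s\<^sub>1 t\<^sub>1 E\<^sub>1) cs (Phi s\<^sub>2 \<sigma>\<^sub>2 t\<^sub>2) =
       (\<lambda>v v'. \<exists>t. Ecsp
          (\<lambda>s. s\<^sub>1 s \<and> s\<^sub>2 s \<and> t \<in> trace_merge cs (t\<^sub>1 s) (t\<^sub>2 s) \<and>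
               trace_restrict (t\<^sub>1 s) cs = trace_restrict (t\<^sub>2 s) cs)
          (\<lambda>s. t)
          (\<lambda>s. E\<^sub>1 s - cs) v v')"
  \<comment> \<open>\<open>Ecsp\<close> forces \<open>t = tt v v'\<close>, which collapses the
    quantifier over \<open>t\<close>.\<close>
  by (auto simp: fun_eq_iff imerge_Ecsp_Ecsp_iff imerge_Ecsp_Phi_iff Ecsp_iff)

end
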